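(* Let $t_0<T<+\infty$ and let $a,b,c,d$ and $a_k,b_k,c_k,d_k$ ($k=1,2$) be real-valued continuous functions on $[t_0,T]$. For $k=1,2$ let $y_k(t)$ be a solution on $[t_0,T]$ of $$y'+a_k(t)y^3+b_k(t)y^2+c_k(t)y+d_k(t)=0,$$ such that $y_1(t_0)\le y_2(t_0)$, $y_1(t_0)\ge y_1(T)$ and $y_2(t_0)\le y_2(T)$. Assume: (i) $a(t)<0$ almost everywhere on $[t_0,T]$, and the function $\frac{b^2(t)}{a(t)}$ is integrable on $[t_0,T]$; (ii) for some $\gamma_1\in[y_1(t_0),y_2(t_0)]$, $$\gamma_1-y_1(t_0)+\int_{t_0}^{t}\exp\Big\{\int_{t_0}^{\tau}\Big[c(s)-\frac{b^2(s)}{a(s)}\Big]ds\Big\}\Big[(a_1(\tau)-a(\tau))y_1^3(\tau)+(b_1(\tau)-b(\tau))y_1^2(\tau)+(c_1(\tau)-c(\tau))y_1(\tau)+d_1(\tau)-d(\tau)\Big]d\tau\ge0$$ for all $t\in[t_0,T]$; (iii) for some $\gamma_2\in[\gamma_1,y_2(t_0)]$, $$\gamma_2-y_2(t_0)+\int_{t_0}^{t}\exp\Big\{\int_{t_0}^{\tau}\Big[c(s)-\frac{b^2(s)}{a(s)}\Big]ds\Big\}\Big[(a_2(\tau)-a(\tau))y_2^3(\tau)+(b_2(\tau)-b(\tau))y_2^2(\tau)+(c_2(\tau)-c(\tau))y_2(\tau)+d_2(\tau)-d(\tau)\Big]d\tau\le0$$ for all $t\in[t_0,T]$. Then the equation $$y'+a(t)y^3+b(t)y^2+c(t)y+d(t)=0$$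 has a closed solution on $[t_0,T]$.
   Context: A solution $y(t)$ of the equation, existing on an interval $[t_0,T]$, is called closed on $[t_0,T]$ if $y(t_0)=y(T)$. A solution on an interval is a real-valued differentiable function satisfying the equation at every point of the interval (one-sided derivatives at the endpoints). "Integrable" means Lebesgue integrable. *)

theory Defs
  imports "HOL-Analysis.Analysis"
begin

text \<open>
  The solution notion lives on the compact interval \<open>{t0..T}\<close>: the derivative is taken within the
  interval, so it is one-sided at the endpoints, and values of \<open>y\<close> outside are irrelevant.
\<close>

definition abel_solution_on ::
  "(real \<Rightarrow> real) \<Rightarrow> (real \<Rightarrow> real) \<Rightarrow> (real \<Rightarrow> real) \<Rightarrow> (real \<Rightarrow> real)
    \<Rightarrow> real \<Rightarrow> real \<Rightarrow> (real \<Rightarrow> real) \<Rightarrow> bool"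
  where
  "abel_solution_on a b c d t0 T y \<longleftrightarrow>
    (\<forall>t\<in>{t0..T}. \<exists>y'. (y has_real_derivative y') (at t within {t0..T}) \<and>
       y' + a t * y t ^ 3 + b t * y t ^ 2 + c t * y t + d t = 0)"

definition abel_closed_solution_on ::
  "(real \<Rightarrow> real) \<Rightarrow> (real \<Rightarrow> real) \<Rightarrow> (real \<Rightarrow> real) \<Rightarrow> (real \<Rightarrow> real)
    \<Rightarrow> real \<Rightarrow> real \<Rightarrow> (real \<Rightarrow> real) \<Rightarrow> bool"
  where
  "abel_closed_solution_on a b c d t0 T y \<longleftrightarrow> abel_solution_on a b c d t0 T y \<and> y t0 = y T"

end

theory Submission
  imports Defs
begin

text \<open>
  Read backwards in time, the equation is dissipative: since \<open>a < 0\<close> almost everywhere, the cubic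
  term pulls \<open>y\<close> towards zero as \<open>t\<close> decreases. So a closed solution is found as a fixed point of
  the backward return map \<open>Q\<close>, which sends \<open>x\<close> to \<open>y(t0)\<close>, where \<open>y\<close> is the solution with
  \<open>y(T) = x\<close>. The map \<open>Q\<close> is continuous, so by the intermediate value theorem it suffices to find
  \<open>R\<close> with \<open>Q(R) \<le> R\<close> and \<open>Q(-R) \<ge> -R\<close>.

  The quantitative tool is the logarithmic energy \<open>ln (1 + y\<^sup>2)\<close>. Its derivative with respect to
  reversed time is \<open>2 y (a y\<^sup>3 + b y\<^sup>2 + c y + d) / (1 + y\<^sup>2)\<close>. Half of the term \<open>a y\<^sup>4\<close> suffices to
  absorb \<open>b y\<^sup>3\<close> at the price of \<open>\<bar>b\<^sup>2 / a\<bar> y\<^sup>2\<close>, so the rate is at most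
  \<open>h = 2 (\<bar>b\<^sup>2 / a\<bar> + \<bar>c\<bar> + \<bar>d\<bar>)\<close> (\<open>log_energy_rate_le\<close>). This \<open>h\<close> is integrable and does not involve
  \<open>y\<close>; with \<open>H\<close> its integral over \<open>{t0..T}\<close>, the energy rises by at most \<open>H\<close> on the way back. Hence
  \<open>1 + y\<^sup>2\<close> grows at most by the factor \<open>exp H\<close>, and no solution blows up backwards. The other half of
  \<open>a y\<^sup>4\<close> gives decay: as long as \<open>y\<^sup>2 \<ge> N \<ge> 1\<close>, the rate is at most \<open>N a / 2 + h\<close>
  (\<open>log_energy_rate_le_damped\<close>), and as the integral of \<open>a\<close> is negative, a large \<open>N\<close> makes the total
  change negative. If \<open>R\<close> is so large that a solution with \<open>\<bar>y(T)\<bar> = R < \<bar>y(t0)\<bar>\<close> could never have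
  had \<open>y\<^sup>2 < N\<close>, this is a contradiction, so \<open>\<bar>Q(R)\<bar> \<le> R\<close> and \<open>\<bar>Q(-R)\<bar> \<le> R\<close>.

  Solutions that depend continuously on their terminal value come from the contraction principle for
  right-hand sides that are globally Lipschitz in \<open>y\<close> (\<open>terminal_value_solutions\<close>). It is applied to
  the equation in which \<open>y\<close> is clamped to \<open>{-K..K}\<close> inside the cubic. The growth estimate holds for the
  clamped equation as well, with the same \<open>H\<close>, so with \<open>K\<close> chosen from \<open>R\<close> and \<open>H\<close> the clamping is never
  active on solutions with \<open>\<bar>y(T)\<bar> \<le> R\<close>.
\<close>

section \<open>Terminal value problems with globally Lipschitz right-hand side\<close>

text \<open>
  The integral equation \<open>y(t) = x + \<integral>\<^sub>t\<^sup>T G(r, y(r)) dr\<close> is solved for \<open>u = y / w\<close>, where the weight is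
  \<open>w(t) = exp (2 L (T - t))\<close>. In the sup norm of \<open>u\<close> the integral operator is then a contraction with
  constant \<open>1/2\<close> on the whole interval, whatever its length, and its dependence on \<open>x\<close> is
  nonexpansive; together these make the fixed point Lipschitz in \<open>x\<close>.
\<close>

lemma terminal_value_solutions:
  fixes G :: "real \<Rightarrow> real \<Rightarrow> real"
  assumes le: "t0 \<le> T" and "L > 0"
    and cont: "continuous_on ({t0..T} \<times> UNIV) (\<lambda>(t, y). G t y)"
    and lip: "\<And>t x y. t \<in> {t0..T} \<Longrightarrow> \<bar>G t x - G t y\<bar> \<le> L * \<bar>x - y\<bar>"
  obtains Y where "\<And>x. Y x T = x"
    and "\<And>x t. t \<in> {t0..T} \<Longrightarrow> (Y x has_real_derivative - G t (Y x t)) (at t within {t0..T})"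
    and "continuous_on UNIV (\<lambda>x. Y x t0)"
proof -
  define w where "w = (\<lambda>t. exp (2 * L * (T - t)))"
  have w_cont: "continuous_on S w" for S
    unfolding w_def by (intro continuous_intros)
  have w_ge: "1 \<le> w t" if "t \<in> {t0..T}" for t
    using that \<open>L > 0\<close> by (simp add: w_def)
  define A where "A = (\<lambda>x u t. (x + integral {t..T} (\<lambda>r. G r (w r * u r))) / w t)"
  have rhs_cont: "continuous_on {t..T} (\<lambda>r. G r (f r))"
    if "continuous_on {t0..T} f" "t \<in> {t0..T}" for f t
  proof -
    have "continuous_on {t0..T} (\<lambda>r. (\<lambda>(t, y). G t y) (r, f r))"
      by (rule continuous_on_compose2[OF cont]) (auto intro!: continuous_intros that)
    then show ?thesis
      using that by (auto elim!: continuous_on_subset)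
  qed
  \<comment> \<open>Clamping the time argument extends \<open>A x u\<close> to a bounded continuous function on the line, so
      that the fixed point can be sought in the complete space of such functions.\<close>
  have "\<exists>v :: real \<Rightarrow>\<^sub>C real. (\<forall>t. v t = A x u (clamp t0 T t))" for x and u :: "real \<Rightarrow>\<^sub>C real"
  proof -
    have "continuous_on {t0..T} (\<lambda>t. integral {t..T} (\<lambda>r. G r (w r * u r)))"
      by (rule DERIV_continuous_on, rule integral_has_real_derivative')
         (use le in \<open>auto intro!: rhs_cont continuous_intros w_cont\<close>)
    then have "continuous_on {t0..T} (A x u)"
      unfolding A_def by (intro continuous_intros w_cont) (auto simp: w_def)
    then have "continuous_on (cbox t0 T) (A x u)"
      by simp
    from continuous_on_cbox_bcontfunE[OF this] show ?thesis
      by metis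
  qed
  then obtain \<Phi> :: "real \<Rightarrow> (real \<Rightarrow>\<^sub>C real) \<Rightarrow> (real \<Rightarrow>\<^sub>C real)"
    where \<Phi>: "\<And>x u t. \<Phi> x u t = A x u (clamp t0 T t)"
    by metis
  have A_diff: "\<bar>A x u t - A x' v t\<bar> \<le> \<bar>x - x'\<bar> + dist u v / 2"
    if t: "t \<in> {t0..T}" for x x' t and u v :: "real \<Rightarrow>\<^sub>C real"
  proof -
    define D where "D = dist u v"
    have int: "(\<lambda>r. G r (w r * u r)) integrable_on {t..T}" for u :: "real \<Rightarrow>\<^sub>C real"
      by (intro integrable_continuous_real rhs_cont t continuous_intros w_cont) auto
    have wint: "((\<lambda>r. L * D * w r) has_integral D / 2 * (w t - 1)) {t..T}"
    proof -
      have "((\<lambda>r. L * D * w r) has_integral - (D / 2 * w T) - - (D / 2 * w t)) {t..T}"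
        using t \<open>L > 0\<close> unfolding w_def
        by (intro fundamental_theorem_of_calculus)
           (auto intro!: derivative_eq_intros simp flip: has_real_derivative_iff_has_vector_derivative)
      then show ?thesis
        by (simp add: w_def algebra_simps)
    qed
    have bound: "\<bar>G r (w r * u r) - G r (w r * v r)\<bar> \<le> L * D * w r" if r: "r \<in> {t..T}" for r
    proof -
      have "\<bar>G r (w r * u r) - G r (w r * v r)\<bar> \<le> L * \<bar>w r * u r - w r * v r\<bar>"
        using r t by (intro lip) auto
      also have "\<dots> = L * (w r * dist (u r) (v r))"
        by (simp add: dist_real_def w_def abs_mult flip: right_diff_distrib)
      also have "\<dots> \<le> L * (w r * D)"
        using \<open>L > 0\<close> dist_bounded[of u r v] unfolding D_def
        by (intro mult_left_mono) (auto simp: w_def)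
      finally show ?thesis by (simp add: mult_ac)
    qed
    have "\<bar>integral {t..T} (\<lambda>r. G r (w r * u r)) - integral {t..T} (\<lambda>r. G r (w r * v r))\<bar>
        = norm (integral {t..T} (\<lambda>r. G r (w r * u r) - G r (w r * v r)))"
      by (simp add: integral_diff int)
    also have "\<dots> \<le> integral {t..T} (\<lambda>r. L * D * w r)"
      using wint bound by (intro integral_norm_bound_integral integrable_diff int) auto
    also have "\<dots> = D / 2 * (w t - 1)"
      using wint by (rule integral_unique)
    finally have I: "\<bar>integral {t..T} (\<lambda>r. G r (w r * u r)) - integral {t..T} (\<lambda>r. G r (w r * v r))\<bar>
       \<le> D / 2 * (w t - 1)" .
    have "\<bar>A x u t - A x' v t\<bar> = \<bar>(x - x') + (integral {t..T} (\<lambda>r. G r (w r * u r))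
        - integral {t..T} (\<lambda>r. G r (w r * v r)))\<bar> / w t"
      using w_ge[OF t] by (simp add: A_def algebra_simps flip: diff_divide_distrib)
    also have "\<dots> \<le> (\<bar>x - x'\<bar> + D / 2 * (w t - 1)) / w t"
      using I w_ge[OF t]
      by (intro divide_right_mono order_trans[OF abs_triangle_ineq] add_left_mono) auto
    also have "\<dots> \<le> \<bar>x - x'\<bar> + D / 2"
    proof -
      have "\<bar>x - x'\<bar> * 1 \<le> \<bar>x - x'\<bar> * w t" "0 \<le> D"
        using w_ge[OF t] by (intro mult_left_mono) (auto simp: D_def)
      then show ?thesis
        using w_ge[OF t] by (simp add: divide_simps algebra_simps)
    qed
    finally show ?thesis unfolding D_def .
  qed
  have clamp_in: "clamp t0 T t \<in> {t0..T}" for t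
    using clamp_in_interval[of t0 T t] le by simp
  have \<Phi>_dist: "dist (\<Phi> x u) (\<Phi> x' v) \<le> \<bar>x - x'\<bar> + dist u v / 2" for x x' u v
    by (rule dist_bound) (use A_diff[OF clamp_in] in \<open>simp add: \<Phi> dist_real_def\<close>)
  have "\<exists>u. \<Phi> x u = u" for x
  proof -
    have "\<exists>!u. \<Phi> x u = u"
      using \<Phi>_dist[of x _ x] by (intro banach_fix_type[of "1/2"]) auto
    then show ?thesis by blast
  qed
  then obtain U where U: "\<And>x. \<Phi> x (U x) = U x"
    by metis
  have U_lip: "dist (U x) (U x') \<le> 2 * \<bar>x - x'\<bar>" for x x'
    using \<Phi>_dist[of x "U x" x' "U x'"] by (simp add: U)
  define Y where "Y = (\<lambda>x t. w t * U x t)"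
  have Y_eq: "Y x t = x + integral {t..T} (\<lambda>r. G r (Y x r))" if "t \<in> {t0..T}" for x t
  proof -
    have "U x t = A x (U x) t"
      using \<Phi>[of x "U x" t] that by (simp add: U)
    then show ?thesis
      using w_ge[OF that] by (simp add: Y_def A_def)
  qed
  show ?thesis
  proof
    show "Y x T = x" for x
      using Y_eq[of T x] le by simp
    show "(Y x has_real_derivative - G t (Y x t)) (at t within {t0..T})" if "t \<in> {t0..T}" for x t
    proof -
      have "continuous_on {t0..T} (\<lambda>r. G r (Y x r))"
        using le unfolding Y_def by (intro rhs_cont continuous_intros w_cont) auto
      from integral_has_real_derivative'[OF this that]
      have "((\<lambda>t. x + integral {t..T} (\<lambda>r. G r (Y x r))) has_real_derivative - G t (Y x t))
          (at t within {t0..T})"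
        by (auto intro!: derivative_eq_intros)
      then show ?thesis
        using that by (rule has_field_derivative_transform_within[OF _ zero_less_one])
                      (simp add: Y_eq)
    qed
    have "(w t0 * 2)-lipschitz_on UNIV (\<lambda>x. Y x t0)"
    proof (rule lipschitz_onI)
      fix x x'
      have "dist (Y x t0) (Y x' t0) = w t0 * dist (U x t0) (U x' t0)"
        by (simp add: Y_def dist_real_def w_def abs_mult flip: right_diff_distrib)
      also have "\<dots> \<le> w t0 * (2 * \<bar>x - x'\<bar>)"
        using dist_bounded[of "U x" t0 "U x'"] U_lip[of x x']
        by (intro mult_left_mono) (auto simp: w_def)
      finally show "dist (Y x t0) (Y x' t0) \<le> w t0 * 2 * dist x x'"
        by (simp add: dist_real_def)
    qed (simp add: w_def)
    then show "continuous_on UNIV (\<lambda>x. Y x t0)"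
      by (rule lipschitz_on_continuous_on)
  qed
qed

section \<open>The logarithmic energy\<close>

lemma log_energy_diff_le:
  fixes y y' \<phi> :: "real \<Rightarrow> real"
  assumes "s \<le> t"
    and y: "\<And>r. r \<in> {s..t} \<Longrightarrow> (y has_real_derivative y' r) (at r within {s..t})"
    and y': "continuous_on {s..t} y'"
    and \<phi>: "\<phi> absolutely_integrable_on {s..t}"
    and le: "AE r\<in>{s..t} in lebesgue. 2 * y r * - y' r / (1 + y r ^ 2) \<le> \<phi> r"
  shows "ln (1 + y s ^ 2) - ln (1 + y t ^ 2) \<le> integral {s..t} \<phi>"
proof -
  define f where "f = (\<lambda>r. 2 * y r * - y' r / (1 + y r ^ 2))"
  have pos: "1 + x ^ 2 > 0" for x :: real
    using zero_le_power2[of x] by linarith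
  have "(f has_integral (- ln (1 + y t ^ 2) - - ln (1 + y s ^ 2))) {s..t}"
    using \<open>s \<le> t\<close> y pos unfolding f_def
    by (intro fundamental_theorem_of_calculus)
       (auto intro!: derivative_eq_intros simp: field_simps
        simp flip: has_real_derivative_iff_has_vector_derivative)
  then have "ln (1 + y s ^ 2) - ln (1 + y t ^ 2) = integral {s..t} f"
    by (simp add: integral_unique)
  moreover have f_int: "f absolutely_integrable_on {s..t}"
  proof (rule absolutely_integrable_continuous_real)
    have "continuous_on {s..t} y"
      using y by (rule DERIV_continuous_on)
    moreover have "1 + y r ^ 2 \<noteq> 0" for r
      using pos[of "y r"] by simp
    ultimately show "continuous_on {s..t} f"
      unfolding f_def by (intro continuous_intros y') auto
  qed
  ultimately show ?thesis
    using set_integral_mono_AE[OF f_int \<phi>] le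
    by (simp add: set_lebesgue_integral_eq_integral f_int \<phi>) (simp add: f_def)
qed

text \<open>
  Completing the square in \<open>A p\<^sup>2 / 2 + B p\<close> absorbs the linear term into half of the negative
  quadratic one; the other half is kept, as it is the source of the damping.
\<close>
lemma quadratic_le_half:
  fixes A B C p :: real
  assumes "A < 0"
  shows "A * p ^ 2 + B * p + C \<le> A * p ^ 2 / 2 + (\<bar>B ^ 2 / A\<bar> + \<bar>C\<bar>)"
proof -
  have "A * (A * p ^ 2 / 2 + B * p + B ^ 2 / A) = ((A * p + B) ^ 2 + B ^ 2) / 2"
    using assms by (simp add: field_simps power2_eq_square)
  also have "\<dots> \<ge> 0"
    by simp
  finally have "A * (A * p ^ 2 / 2 + B * p + B ^ 2 / A) \<ge> 0" .
  then have "A * p ^ 2 / 2 + B * p + B ^ 2 / A \<le> 0"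
    using assms by (simp add: zero_le_mult_iff)
  then show ?thesis
    by linarith
qed

lemma mult_le_square_mult_abs: "p * D \<le> (1 + p ^ 2) * \<bar>D\<bar>" for p D :: real
proof -
  have "0 \<le> (1 - \<bar>p\<bar>) ^ 2 + p ^ 2" by simp
  then have "\<bar>p\<bar> \<le> 1 + p ^ 2"
    by (simp add: power2_diff)
  then have "\<bar>p * D\<bar> \<le> (1 + p ^ 2) * \<bar>D\<bar>"
    by (simp add: abs_mult mult_right_mono)
  then show ?thesis
    by linarith
qed

text \<open>
  The product of \<open>p\<close> with the cubic at \<open>q\<close> is \<open>p q\<close> times a quadratic in \<open>q\<close> that is bounded
  above, plus \<open>p D\<close>. Here \<open>q\<close> stands for \<open>p\<close> clamped to a symmetric interval; only the sign and size of
  \<open>p q\<close> enter, so the bound is the same for every clamping level.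
\<close>
lemma log_energy_rate_le:
  fixes A B C D p q :: real
  assumes A: "A < 0" and pq: "0 \<le> p * q" "p * q \<le> p ^ 2"
  shows "2 * p * (A * q ^ 3 + B * q ^ 2 + C * q + D) / (1 + p ^ 2)
      \<le> 2 * (\<bar>B ^ 2 / A\<bar> + \<bar>C\<bar> + \<bar>D\<bar>)"
proof -
  define M where "M = \<bar>B ^ 2 / A\<bar> + \<bar>C\<bar>"
  have "A * q ^ 2 \<le> 0"
    using A by (simp add: mult_le_0_iff)
  then have "A * q ^ 2 + B * q + C \<le> M"
    using quadratic_le_half[OF A, of q B C] unfolding M_def by linarith
  then have "(p * q) * (A * q ^ 2 + B * q + C) \<le> (p * q) * M"
    using pq by (intro mult_left_mono) auto
  also have "\<dots> \<le> (1 + p ^ 2) * M"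
    using pq by (intro mult_right_mono) (auto simp: M_def)
  finally have 1: "(p * q) * (A * q ^ 2 + B * q + C) \<le> (1 + p ^ 2) * M" .
  from 1 mult_le_square_mult_abs[of p D]
  have "p * (A * q ^ 3 + B * q ^ 2 + C * q + D) \<le> (1 + p ^ 2) * (M + \<bar>D\<bar>)"
    by (simp add: algebra_simps power2_eq_square power3_eq_cube)
  then have "p * (A * q ^ 3 + B * q ^ 2 + C * q + D) / (1 + p ^ 2) \<le> M + \<bar>D\<bar>"
    by (simp add: pos_divide_le_eq add_pos_nonneg mult.commute)
  then show ?thesis
    by (simp add: M_def)
qed

text \<open>
  For \<open>p\<^sup>2 \<ge> N \<ge> 1\<close> the retained half of the quartic term still gives, after division by \<open>1 + p\<^sup>2\<close>, a
  decay rate proportional to \<open>N\<close>, because \<open>p\<^sup>2 / (1 + p\<^sup>2) \<ge> 1/2\<close>.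
\<close>
lemma log_energy_rate_le_damped:
  fixes A B C D p N :: real
  assumes A: "A < 0" and N: "1 \<le> N" "N \<le> p ^ 2"
  shows "2 * p * (A * p ^ 3 + B * p ^ 2 + C * p + D) / (1 + p ^ 2)
      \<le> N / 2 * A + 2 * (\<bar>B ^ 2 / A\<bar> + \<bar>C\<bar> + \<bar>D\<bar>)"
proof -
  define M where "M = \<bar>B ^ 2 / A\<bar> + \<bar>C\<bar>"
  have "p ^ 2 * (A * p ^ 2 + B * p + C) \<le> p ^ 2 * (A * p ^ 2 / 2 + M)"
    using quadratic_le_half[OF A, of p B C] unfolding M_def by (intro mult_left_mono) auto
  also have "\<dots> \<le> (1 + p ^ 2) * (A * N / 4 + M)"
  proof -
    have "N * (1 + p ^ 2) \<le> p ^ 2 * (2 * p ^ 2)"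
      using N by (intro mult_mono) auto
    then have "A * (p ^ 2 * (2 * p ^ 2)) \<le> A * (N * (1 + p ^ 2))"
      using A by (intro mult_left_mono_neg) auto
    then have "p ^ 2 * (A * p ^ 2 / 2) \<le> (1 + p ^ 2) * (A * N / 4)"
      by (simp add: algebra_simps)
    moreover have "p ^ 2 * M \<le> (1 + p ^ 2) * M"
      by (intro mult_right_mono) (auto simp: M_def)
    ultimately show ?thesis
      by (simp only: distrib_left add_mono)
  qed
  finally have 1: "p ^ 2 * (A * p ^ 2 + B * p + C) \<le> (1 + p ^ 2) * (A * N / 4 + M)" .
  from 1 mult_le_square_mult_abs[of p D]
  have "p * (A * p ^ 3 + B * p ^ 2 + C * p + D) \<le> (1 + p ^ 2) * (A * N / 4 + M + \<bar>D\<bar>)"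
    by (simp add: algebra_simps power2_eq_square power3_eq_cube)
  then have "p * (A * p ^ 3 + B * p ^ 2 + C * p + D) / (1 + p ^ 2) \<le> A * N / 4 + M + \<bar>D\<bar>"
    by (simp add: pos_divide_le_eq add_pos_nonneg mult.commute)
  then have "2 * (p * (A * p ^ 3 + B * p ^ 2 + C * p + D) / (1 + p ^ 2)) \<le> 2 * (A * N / 4 + M + \<bar>D\<bar>)"
    by (rule mult_left_mono) simp
  also have "\<dots> = N / 2 * A + 2 * (M + \<bar>D\<bar>)"
    by (simp add: algebra_simps)
  finally show ?thesis
    by (simp add: M_def)
qed

lemma integral_neg_of_AE_neg:
  fixes a :: "real \<Rightarrow> real"
  assumes "t0 < T" and a: "continuous_on {t0..T} a"
    and "AE t\<in>{t0..T} in lebesgue. a t < 0"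
  shows "integral {t0..T} a < 0"
proof -
  have ai: "a absolutely_integrable_on {t0..T}"
    using a by (rule absolutely_integrable_continuous_real)
  interpret finite_measure "lebesgue_on {t0..T}"
    by (rule finite_measure_lebesgue_on) auto
  have "integral\<^sup>L (lebesgue_on {t0..T}) a < integral\<^sup>L (lebesgue_on {t0..T}) (\<lambda>_. 0)"
  proof (rule integral_less_AE_space)
    show "integrable (lebesgue_on {t0..T}) a"
      using ai by (simp add: absolutely_integrable_imp_integrable)
    show "AE t in lebesgue_on {t0..T}. a t < 0"
      using assms by (simp add: AE_restrict_space_iff)
    show "emeasure (lebesgue_on {t0..T}) (space (lebesgue_on {t0..T})) \<noteq> 0"
      using \<open>t0 < T\<close> by (simp add: emeasure_restrict_space)
  qed simp
  then show ?thesis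
    using ai by (simp add: lebesgue_integral_eq_integral absolutely_integrable_imp_integrable)
qed


section \<open>Closed solutions as fixed points of the backward return map\<close>

lemma cubic_lipschitz:
  fixes A B C D p q K :: real
  assumes "\<bar>p\<bar> \<le> K" "\<bar>q\<bar> \<le> K"
  shows "\<bar>(A * p ^ 3 + B * p ^ 2 + C * p + D) - (A * q ^ 3 + B * q ^ 2 + C * q + D)\<bar>
      \<le> (3 * \<bar>A\<bar> * K ^ 2 + 2 * \<bar>B\<bar> * K + \<bar>C\<bar>) * \<bar>p - q\<bar>"
proof -
  have K: "0 \<le> K" using assms by linarith
  have "\<bar>p ^ 2 + p * q + q ^ 2\<bar> \<le> \<bar>p * p\<bar> + \<bar>p * q\<bar> + \<bar>q * q\<bar>"
    unfolding power2_eq_square by linarith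
  also have "\<dots> = \<bar>p\<bar> * \<bar>p\<bar> + \<bar>p\<bar> * \<bar>q\<bar> + \<bar>q\<bar> * \<bar>q\<bar>"
    by (simp only: abs_mult)
  also have "\<dots> \<le> K * K + K * K + K * K"
    using assms K by (intro add_mono mult_mono) auto
  finally have "\<bar>A * (p ^ 2 + p * q + q ^ 2)\<bar> \<le> \<bar>A\<bar> * (K * K + K * K + K * K)"
    by (simp add: abs_mult mult_left_mono)
  moreover have "\<bar>B * (p + q)\<bar> \<le> \<bar>B\<bar> * (2 * K)"
    unfolding abs_mult using assms by (intro mult_left_mono) auto
  ultimately have "\<bar>A * (p ^ 2 + p * q + q ^ 2) + B * (p + q) + C\<bar>
      \<le> 3 * \<bar>A\<bar> * K ^ 2 + 2 * \<bar>B\<bar> * K + \<bar>C\<bar>"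
    by (simp add: power2_eq_square algebra_simps)
  then have "\<bar>A * (p ^ 2 + p * q + q ^ 2) + B * (p + q) + C\<bar> * \<bar>p - q\<bar>
      \<le> (3 * \<bar>A\<bar> * K ^ 2 + 2 * \<bar>B\<bar> * K + \<bar>C\<bar>) * \<bar>p - q\<bar>"
    by (rule mult_right_mono) simp
  moreover have "(A * p ^ 3 + B * p ^ 2 + C * p + D) - (A * q ^ 3 + B * q ^ 2 + C * q + D)
      = (A * (p ^ 2 + p * q + q ^ 2) + B * (p + q) + C) * (p - q)"
    by (simp add: power2_eq_square power3_eq_cube algebra_simps)
  ultimately show ?thesis
    by (simp only: abs_mult)
qed

text \<open>
  The constants are fixed in the order \<open>N\<close>, \<open>R\<close>, \<open>K\<close>: the damping on the region \<open>y\<^sup>2 \<ge> N\<close> outweighs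
  \<open>H\<close>; a solution that is beyond \<open>R\<close> at \<open>t0\<close> stays in that region; a solution that starts within \<open>R\<close> at
  \<open>T\<close> stays within \<open>K\<close>.
\<close>
theorem abel_closed_solution_if_leading_coeff_neg:
  fixes t0 T :: real and a b c d :: "real \<Rightarrow> real"
  assumes "t0 < T"
    and a: "continuous_on {t0..T} a" and b: "continuous_on {t0..T} b"
    and c: "continuous_on {t0..T} c" and d: "continuous_on {t0..T} d"
    and neg: "AE t\<in>{t0..T} in lebesgue. a t < 0"
    and quot: "set_integrable lebesgue {t0..T} (\<lambda>t. b t ^ 2 / a t)"
  shows "\<exists>y. abel_closed_solution_on a b c d t0 T y"
proof -
  define h where "h = (\<lambda>t. 2 * (\<bar>b t ^ 2 / a t\<bar> + \<bar>c t\<bar> + \<bar>d t\<bar>))"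
  define H where "H = integral {t0..T} h"
  define \<alpha> where "\<alpha> = - integral {t0..T} a"
  define N where "N = 1 + 2 * H / \<alpha>"
  define R where "R = sqrt ((1 + N) * exp H - 1)"
  define K where "K = sqrt ((1 + R ^ 2) * exp H - 1)"
  have h_int: "h absolutely_integrable_on {t0..T}"
    unfolding h_def using quot c d
    by (intro set_integrable_mult_right set_integral_add(1) set_integrable_abs)
       (simp_all add: absolutely_integrable_continuous_real)
  have h_int': "h absolutely_integrable_on {s..t}" if "t0 \<le> s" "t \<le> T" for s t
    using that by (intro absolutely_integrable_on_subinterval[OF h_int]) auto
  have h_nonneg: "0 \<le> h t" for t
    by (simp add: h_def)
  have "0 \<le> H"
    unfolding H_def by (simp add: h_int integral_nonneg h_nonneg set_lebesgue_integral_eq_integral)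
  have "0 < \<alpha>"
    unfolding \<alpha>_def using integral_neg_of_AE_neg[OF \<open>t0 < T\<close> a neg] by simp
  have "1 \<le> N"
    using \<open>0 \<le> H\<close> \<open>0 < \<alpha>\<close> by (simp add: N_def)
  have "1 \<le> exp H"
    using \<open>0 \<le> H\<close> by simp
  have "1 * 1 \<le> (1 + N) * exp H"
    using \<open>1 \<le> exp H\<close> \<open>1 \<le> N\<close> by (intro mult_mono) auto
  then have R: "0 \<le> R" "1 + R ^ 2 = (1 + N) * exp H"
    by (simp_all add: R_def)
  have "1 * 1 \<le> (1 + R ^ 2) * exp H"
    using \<open>1 \<le> exp H\<close> by (intro mult_mono) auto
  then have K: "0 \<le> K" "1 + K ^ 2 = (1 + R ^ 2) * exp H"
    by (simp_all add: K_def)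

  define q where "q = (\<lambda>y. max (- K) (min K y))"
  have q_bound: "\<bar>q y\<bar> \<le> K" and q_id: "\<bar>y\<bar> \<le> K \<Longrightarrow> q y = y" for y
    using K(1) by (auto simp: q_def)
  have q_lip: "\<bar>q x - q y\<bar> \<le> \<bar>x - y\<bar>" for x y
    by (auto simp: q_def)
  have q_mult: "0 \<le> y * q y \<and> y * q y \<le> y ^ 2" for y
  proof (cases "0 \<le> y")
    case True
    then have "0 \<le> q y" "q y \<le> y"
      using K(1) by (auto simp: q_def)
    with True show ?thesis
      by (simp add: power2_eq_square mult_left_mono)
  next
    case False
    then have "q y \<le> 0" "y \<le> q y"
      using K(1) by (auto simp: q_def)
    with False show ?thesis
      by (simp add: power2_eq_square mult_left_mono_neg mult_nonpos_nonpos)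
  qed
  define G where "G = (\<lambda>t y. a t * q y ^ 3 + b t * q y ^ 2 + c t * q y + d t)"
  obtain A where A: "0 \<le> A" "\<And>t. t \<in> {t0..T} \<Longrightarrow> \<bar>a t\<bar> \<le> A"
    using continuous_on_compact_bound[OF compact_Icc a] by auto
  obtain B where B: "0 \<le> B" "\<And>t. t \<in> {t0..T} \<Longrightarrow> \<bar>b t\<bar> \<le> B"
    using continuous_on_compact_bound[OF compact_Icc b] by auto
  obtain C where C: "0 \<le> C" "\<And>t. t \<in> {t0..T} \<Longrightarrow> \<bar>c t\<bar> \<le> C"
    using continuous_on_compact_bound[OF compact_Icc c] by auto
  define L where "L = 3 * A * K ^ 2 + 2 * B * K + C + 1"
  have "0 < L"
    using A B C K by (simp add: L_def add_nonneg_pos)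
  have G_cont: "continuous_on ({t0..T} \<times> UNIV) (\<lambda>(t, y). G t y)"
    unfolding G_def q_def split_beta
    by (intro continuous_intros continuous_on_compose2[OF a] continuous_on_compose2[OF b]
        continuous_on_compose2[OF c] continuous_on_compose2[OF d]) auto
  have G_lip: "\<bar>G t x - G t y\<bar> \<le> L * \<bar>x - y\<bar>" if t: "t \<in> {t0..T}" for t x y
  proof -
    have "\<bar>G t x - G t y\<bar> \<le> (3 * \<bar>a t\<bar> * K ^ 2 + 2 * \<bar>b t\<bar> * K + \<bar>c t\<bar>) * \<bar>q x - q y\<bar>"
      unfolding G_def by (intro cubic_lipschitz q_bound)
    also have "\<dots> \<le> L * \<bar>x - y\<bar>"
    proof (rule mult_mono)
      have "3 * \<bar>a t\<bar> * K ^ 2 + 2 * \<bar>b t\<bar> * K + \<bar>c t\<bar> \<le> 3 * A * K ^ 2 + 2 * B * K + C"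
        using A(2)[OF t] B(2)[OF t] C(2)[OF t] K by (intro add_mono mult_right_mono) auto
      then show "3 * \<bar>a t\<bar> * K ^ 2 + 2 * \<bar>b t\<bar> * K + \<bar>c t\<bar> \<le> L"
        by (simp add: L_def)
    qed (use q_lip \<open>0 < L\<close> in auto)
    finally show ?thesis .
  qed
  obtain Y where Y_T: "\<And>x. Y x T = x"
    and Y_deriv: "\<And>x t. t \<in> {t0..T} \<Longrightarrow>
        (Y x has_real_derivative - G t (Y x t)) (at t within {t0..T})"
    and Y_cont: "continuous_on UNIV (\<lambda>x. Y x t0)"
    using terminal_value_solutions[OF less_imp_le[OF \<open>t0 < T\<close>] \<open>0 < L\<close> G_cont G_lip] by blast
  have GY_cont: "continuous_on {t0..T} (\<lambda>r. - G r (Y x r))" for x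
  proof -
    have "continuous_on {t0..T} (Y x)"
      using Y_deriv by (rule DERIV_continuous_on)
    then have "continuous_on {t0..T} (\<lambda>r. (\<lambda>(t, y). G t y) (r, Y x r))"
      by (intro continuous_on_compose2[OF G_cont] continuous_intros) auto
    then show ?thesis
      by (simp add: continuous_on_minus)
  qed
  \<comment> \<open>The rate is only controlled where \<open>a < 0\<close>; the exceptional null set does not affect the
      integral. At a zero of \<open>a\<close> the quotient \<open>b\<^sup>2 / a\<close> is \<open>0\<close> by convention and bounds nothing.\<close>
  have energy: "ln (1 + Y x s ^ 2) - ln (1 + Y x t ^ 2) \<le> integral {s..t} \<phi>"
    if st: "t0 \<le> s" "s \<le> t" "t \<le> T" and \<phi>: "\<phi> absolutely_integrable_on {s..t}"
      and rate: "\<And>r. r \<in> {s..t} \<Longrightarrow> a r < 0 \<Longrightarrow>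
        2 * Y x r * G r (Y x r) / (1 + Y x r ^ 2) \<le> \<phi> r" for x s t \<phi>
  proof (rule log_energy_diff_le[where y' = "\<lambda>r. - G r (Y x r)"])
    have sub: "{s..t} \<subseteq> {t0..T}"
      using st by auto
    show "(Y x has_real_derivative - G r (Y x r)) (at r within {s..t})" if "r \<in> {s..t}" for r
      using Y_deriv sub that by (blast intro: has_field_derivative_subset)
    show "continuous_on {s..t} (\<lambda>r. - G r (Y x r))"
      using GY_cont sub by (rule continuous_on_subset)
    show "AE r\<in>{s..t} in lebesgue. 2 * Y x r * - (- G r (Y x r)) / (1 + Y x r ^ 2) \<le> \<phi> r"
      using neg by eventually_elim (use sub rate in auto)
  qed (use st \<phi> in auto)
  have growth: "1 + Y x s ^ 2 \<le> (1 + Y x t ^ 2) * exp H"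
    if st: "t0 \<le> s" "s \<le> t" "t \<le> T" for x s t
  proof -
    have "ln (1 + Y x s ^ 2) - ln (1 + Y x t ^ 2) \<le> integral {s..t} h"
    proof (rule energy[OF st h_int'])
      show "2 * Y x r * G r (Y x r) / (1 + Y x r ^ 2) \<le> h r" if "a r < 0" for r
        unfolding G_def h_def using q_mult by (intro log_energy_rate_le that) auto
    qed (use st in auto)
    also have "\<dots> \<le> H"
      unfolding H_def using st h_int h_int' h_nonneg
      by (intro integral_subset_le set_lebesgue_integral_eq_integral) auto
    finally have "exp (ln (1 + Y x s ^ 2)) \<le> exp (ln (1 + Y x t ^ 2) + H)"
      by simp
    moreover have "0 < 1 + r ^ 2" for r :: real
      by (simp add: add_pos_nonneg)
    ultimately show ?thesis
      by (simp add: exp_add)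
  qed
  have Y_bound: "\<bar>Y x t\<bar> \<le> K" if "\<bar>x\<bar> \<le> R" "t \<in> {t0..T}" for x t
  proof -
    have "1 + Y x t ^ 2 \<le> (1 + x ^ 2) * exp H"
      using growth[of t T x] that by (simp add: Y_T)
    also have "\<dots> \<le> (1 + R ^ 2) * exp H"
      using that R(1) by (intro mult_right_mono) (auto simp: abs_le_square_iff[symmetric])
    also have "\<dots> = 1 + K ^ 2"
      by (simp add: K)
    finally have "Y x t ^ 2 \<le> K ^ 2"
      by simp
    then show ?thesis
      using K(1) by (simp add: abs_le_square_iff[symmetric])
  qed
  have Y_return: "\<bar>Y x t0\<bar> \<le> R" if x: "\<bar>x\<bar> = R" for x
  proof (rule ccontr)
    assume "\<not> \<bar>Y x t0\<bar> \<le> R"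
    then have "\<bar>R\<bar> < \<bar>Y x t0\<bar>"
      using R(1) by simp
    then have larger: "R ^ 2 < Y x t0 ^ 2"
      by (metis abs_le_square_iff not_le)
    \<comment> \<open>Were \<open>\<bar>Y x t\<bar>\<close> ever small, the growth estimate from \<open>t\<close> back to \<open>t0\<close> would leave too little
        room to exceed \<open>R\<close> at \<open>t0\<close>.\<close>
    have far: "N \<le> Y x t ^ 2" if "t \<in> {t0..T}" for t
    proof -
      have "(1 + N) * exp H \<le> (1 + Y x t ^ 2) * exp H"
        using growth[of t0 t x] that larger unfolding R(2)[symmetric] by simp
      then show ?thesis by simp
    qed
    have "ln (1 + Y x t0 ^ 2) - ln (1 + Y x T ^ 2) \<le> integral {t0..T} (\<lambda>r. N / 2 * a r + h r)"
    proof (rule energy)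
      show "(\<lambda>r. N / 2 * a r + h r) absolutely_integrable_on {t0..T}"
        using a by (intro set_integral_add(1) h_int set_integrable_mult_right
            absolutely_integrable_continuous_real) auto
      show "2 * Y x r * G r (Y x r) / (1 + Y x r ^ 2) \<le> N / 2 * a r + h r"
        if "r \<in> {t0..T}" "a r < 0" for r
        using log_energy_rate_le_damped[OF that(2) \<open>1 \<le> N\<close> far[OF that(1)], of "b r" "c r" "d r"]
          q_id[OF Y_bound[of x r]] x that(1)
        by (simp add: G_def h_def)
    qed (use \<open>t0 < T\<close> in auto)
    also have "\<dots> = N / 2 * integral {t0..T} a + H"
      using h_int a unfolding H_def
      by (subst integral_add) (auto intro: set_lebesgue_integral_eq_integral integrable_continuous_real
          intro!: integrable_on_mult_right)
    also have "\<dots> = - \<alpha> / 2"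
      using \<open>0 < \<alpha>\<close> by (simp add: N_def \<alpha>_def field_simps)
    also have "\<dots> < 0"
      using \<open>0 < \<alpha>\<close> by simp
    finally have "ln (1 + Y x t0 ^ 2) < ln (1 + R ^ 2)"
      using x by (auto simp: Y_T)
    moreover have "ln (1 + R ^ 2) < ln (1 + Y x t0 ^ 2)"
      using larger by (simp add: add_pos_nonneg)
    ultimately show False
      by simp
  qed
  have "\<exists>x\<ge>- R. x \<le> R \<and> x - Y x t0 = 0"
  proof (rule IVT')
    show "continuous_on {- R..R} (\<lambda>x. x - Y x t0)"
      by (intro continuous_intros continuous_on_subset[OF Y_cont]) auto
  qed (use Y_return[of R] Y_return[of "- R"] R(1) in auto)
  then obtain x where "- R \<le> x" "x \<le> R" "x - Y x t0 = 0"
    by blast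
  then have x: "\<bar>x\<bar> \<le> R" "Y x t0 = x"
    by auto
  have "\<exists>y'. (Y x has_real_derivative y') (at t within {t0..T}) \<and>
      y' + a t * Y x t ^ 3 + b t * Y x t ^ 2 + c t * Y x t + d t = 0" if t: "t \<in> {t0..T}" for t
    using Y_deriv[OF t, of x] q_id[OF Y_bound[OF x(1) t]]
    by (intro exI[of _ "- G t (Y x t)"]) (simp add: G_def)
  then have "abel_closed_solution_on a b c d t0 T (Y x)"
    using x(2) by (simp add: abel_closed_solution_on_def abel_solution_on_def Y_T)
  then show ?thesis
    by blast
qed

theorem theorem5p6:
  fixes t0 T \<gamma>1 \<gamma>2 :: real
    and a b c d a1 b1 c1 d1 a2 b2 c2 d2 y1 y2 :: "real \<Rightarrow> real"
  assumes "t0 < T"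
    and "continuous_on {t0..T} a" "continuous_on {t0..T} b"
        "continuous_on {t0..T} c" "continuous_on {t0..T} d"
    and "continuous_on {t0..T} a1" "continuous_on {t0..T} b1"
        "continuous_on {t0..T} c1" "continuous_on {t0..T} d1"
    and "continuous_on {t0..T} a2" "continuous_on {t0..T} b2"
        "continuous_on {t0..T} c2" "continuous_on {t0..T} d2"
    and "abel_solution_on a1 b1 c1 d1 t0 T y1"
    and "abel_solution_on a2 b2 c2 d2 t0 T y2"
    and "y1 t0 \<le> y2 t0" "y1 t0 \<ge> y1 T" "y2 t0 \<le> y2 T"
    and "AE t\<in>{t0..T} in lebesgue. a t < 0"
    and "set_integrable lebesgue {t0..T} (\<lambda>t. b t ^ 2 / a t)"
    and "\<gamma>1 \<in> {y1 t0..y2 t0}"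
    and "\<And>t. t \<in> {t0..T} \<Longrightarrow>
      \<gamma>1 - y1 t0 +
        (LINT \<tau>:{t0..t}|lebesgue.
           exp (LINT s:{t0..\<tau>}|lebesgue. c s - b s ^ 2 / a s) *
           ((a1 \<tau> - a \<tau>) * y1 \<tau> ^ 3 + (b1 \<tau> - b \<tau>) * y1 \<tau> ^ 2
             + (c1 \<tau> - c \<tau>) * y1 \<tau> + d1 \<tau> - d \<tau>)) \<ge> 0"
    and "\<gamma>2 \<in> {\<gamma>1..y2 t0}"
    and "\<And>t. t \<in> {t0..T} \<Longrightarrow>
      \<gamma>2 - y2 t0 +
        (LINT \<tau>:{t0..t}|lebesgue.
           exp (LINT s:{t0..\<tau>}|lebesgue. c s - b s ^ 2 / a s) *
           ((a2 \<tau> - a \<tau>) * y2 \<tau> ^ 3 + (b2 \<tau> - b \<tau>) * y2 \<tau> ^ 2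
             + (c2 \<tau> - c \<tau>) * y2 \<tau> + d2 \<tau> - d \<tau>)) \<le> 0"
  shows "\<exists>y. abel_closed_solution_on a b c d t0 T y"
  using assms by (intro abel_closed_solution_if_leading_coeff_neg)

end
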